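(* Let $n\ge 1$ and let $P\in\mathcal{P}^n_o$ be a $0$-symmetric lattice polytope with exactly $2n$ vertices. Then $$\mathrm{a}_i(P)+\mathrm{a}_{n-i}(P)\ \geq\ \binom{n}{i}\bigl(\mathrm{a}_n(P)+\mathrm{a}_0(P)\bigr),\qquad i=0,\dots,n.$$
   Context: $\mathcal{P}^n_o$ is the set of all convex lattice polytopes $P\subset\mathbb{R}^n$ (vertices in $\mathbb{Z}^n$, $\dim P=n$) that are $0$-symmetric, i.e., $P=-P$. For $S\subset\mathbb{R}^n$, $\mathrm{G}(S)=\#(S\cap\mathbb{Z}^n)$. For a lattice $n$-polytope $P$ the function $k\mapsto \mathrm{G}(kP)$, $k\in\mathbb{N}$, is a polynomial of degree $n$ (the Ehrhart polynomial), and the numbers $\mathrm{a}_i(P)$, $0\le i\le n$, are defined by $\mathrm{G}(kP)=\sum_{i=0}^n \mathrm{a}_i(P)\binom{k+n-i}{n}$. *)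

theory Defs
  imports "HOL-Analysis.Analysis"
begin

definition int_lattice :: "(real ^ 'n) set"
  where "int_lattice = {x. \<forall>i. x $ i \<in> \<int>}"

definition vertices :: "(real ^ 'n) set \<Rightarrow> (real ^ 'n) set"
  where "vertices P = {v. v extreme_point_of P}"

definition symmetric_lattice_polytopes :: "(real ^ 'n) set set"
  where "symmetric_lattice_polytopes =
    {P. polytope P \<and> vertices P \<subseteq> int_lattice \<and> aff_dim P = int CARD('n) \<and> uminus ` P = P}"

text \<open>Only used for bounded \<open>S\<close>, where the intersection is finite.\<close>

definition lattice_count :: "(real ^ 'n) set \<Rightarrow> nat"
  where "lattice_count S = card (S \<inter> int_lattice)"

text \<open>
  The coefficients of the Ehrhart polynomial in the basis of the binomials
  \<open>(k + n - i) choose n\<close> for \<open>i = 0, \<dots>, n\<close>, where \<open>n = CARD('n)\<close>.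
  They are determined by the identity for all \<open>k\<close>; for a lattice \<open>n\<close>-polytope they exist
  by Ehrhart's theorem. The values at indices above \<open>n\<close> are set to \<open>0\<close> only to make
  the function unique. As \<open>i \<le> n\<close>, the natural number subtraction does not truncate.
\<close>

definition ehrhart_coeff :: "(real ^ 'n) set \<Rightarrow> nat \<Rightarrow> real"
  where "ehrhart_coeff P = (THE a.
    (\<forall>i > CARD('n). a i = 0) \<and>
    (\<forall>k::nat. real (lattice_count ((\<lambda>x. real k *\<^sub>R x) ` P)) =
      (\<Sum>i = 0..CARD('n). a i * real ((k + CARD('n) - i) choose CARD('n)))))"

end

theory Submission
  imports Defs
begin

text \<open>
  The \<open>2n\<close> vertices come in pairs \<open>\<plusminus>v\<^sub>1, \<dots>, \<plusminus>v\<^sub>n\<close>, and since they span the space, the \<open>v\<^sub>i\<close> form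
  a basis. In coordinates with respect to this basis \<open>P\<close> is the unit ball of the \<open>l\<^sub>1\<close>-norm, and
  \<open>\<int>\<^sup>n\<close> becomes a lattice \<open>\<Lambda>\<close> that contains the points with integer coordinates, as the \<open>v\<^sub>i\<close> are
  lattice points. So \<open>G(kP)\<close> counts the points of \<open>\<Lambda>\<close> of \<open>l\<^sub>1\<close>-norm at most \<open>k\<close>.

  Every \<open>x \<in> \<Lambda>\<close> arises from a unique point \<open>b \<in> \<Lambda>\<close> of the half-open cube \<open>[-1, 1)\<^sup>n\<close> by moving
  each coordinate an integral distance \<open>\<mu>\<^sub>i \<ge> 0\<close> away from the origin, and then
  \<open>\<parallel>x\<parallel> = \<parallel>b\<parallel> + \<mu>\<^sub>1 + \<dots> + \<mu>\<^sub>n\<close>. The number of \<open>\<mu>\<close> with sum at most \<open>m\<close> is \<open>m + n choose n\<close>.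
  Hence \<open>b\<close> contributes \<open>k + n - j choose n\<close> to \<open>G(kP)\<close>, where \<open>j\<close> is \<open>\<parallel>b\<parallel>\<close> rounded up. This proves
  polynomiality and identifies \<open>a\<^sub>j\<close> as the number of \<open>b \<in> \<Lambda>\<close> in the cube with
  \<open>j - 1 < \<parallel>b\<parallel> \<le> j\<close>, called \<open>shell j\<close> below (\<open>card_l1_ball\<close>).

  For the inequality (\<open>shell_inequality\<close>), let \<open>flip T\<close> shift the coordinates in \<open>T\<close> by \<open>1\<close> towards the
  other sign. It maps the points of \<open>\<Lambda>\<close> in the cube to such points and replaces
  \<open>\<bar>b\<^sub>i\<bar>\<close> by \<open>1 - \<bar>b\<^sub>i\<bar>\<close> for \<open>i \<in> T\<close>. Flipping everything turns \<open>\<parallel>b\<parallel>\<close> into \<open>n - \<parallel>b\<parallel>\<close>, so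
  \<open>a\<^sub>n\<close> counts the set \<open>A\<close> of points with \<open>\<parallel>b\<parallel> < 1\<close>. Flip each \<open>b \<in> A\<close> in every set \<open>T\<close> of \<open>j\<close>
  coordinates. Then \<open>\<parallel>flip T b\<parallel> \<ge> j - \<parallel>b\<parallel> > j - 1\<close>. If also \<open>\<parallel>flip T b\<parallel> \<le> j\<close>, the
  result is counted by \<open>a\<^sub>j\<close>; if \<open>\<parallel>flip T b\<parallel> \<ge> j\<close>, its complementary flip is counted by
  \<open>a\<^sub>n\<^sub>-\<^sub>j\<close>. For \<open>b = 0\<close> both happen, which provides the summand for \<open>a\<^sub>0 = 1\<close>. No point is counted
  twice because the pairs \<open>(b, T)\<close> have distinct flips (\<open>inj_on_flip_l1_ball\<close>).
\<close>

section \<open>The half-open cube and its flips\<close>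

definition l1_norm :: "real ^ 'n \<Rightarrow> real"
  where "l1_norm x = (\<Sum>i\<in>UNIV. \<bar>x $ i\<bar>)"

definition sign_cell :: "(real ^ 'n) set"
  where "sign_cell = {b. \<forall>i. -1 \<le> b $ i \<and> b $ i < 1}"

text \<open>
  The shift by \<open>1\<close> goes downwards from \<open>[0, 1)\<close> and upwards from \<open>[-1, 0)\<close>; on \<open>[-1, 1)\<close> this is
  an involution that preserves residues modulo \<open>1\<close>.
\<close>

definition flip :: "'n set \<Rightarrow> real ^ 'n \<Rightarrow> real ^ 'n"
  where "flip T b = (\<chi> i. if i \<in> T then (if b $ i \<ge> 0 then b $ i - 1 else b $ i + 1) else b $ i)"

lemma l1_norm_nonneg: "0 \<le> l1_norm x"
  by (simp add: l1_norm_def sum_nonneg)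

lemma l1_norm_eq_0_iff: "l1_norm x = 0 \<longleftrightarrow> x = 0"
  by (auto simp: l1_norm_def sum_nonneg_eq_0_iff vec_eq_iff)

lemma l1_norm_triangle: "l1_norm (x + y) \<le> l1_norm x + l1_norm y"
  unfolding l1_norm_def sum.distrib[symmetric]
  by (intro sum_mono) (auto intro: abs_triangle_ineq)

lemma l1_norm_scaleR: "l1_norm (r *\<^sub>R x) = \<bar>r\<bar> * l1_norm x"
  by (simp add: l1_norm_def abs_mult sum_distrib_left)

lemma sign_cellD: "b \<in> sign_cell \<Longrightarrow> -1 \<le> b $ i \<and> b $ i < 1"
  by (simp add: sign_cell_def)

lemma flip_sign_cell:
  assumes "b \<in> sign_cell"
  shows "flip T b \<in> sign_cell"
proof -
  have "-1 \<le> flip T b $ i \<and> flip T b $ i < 1" for i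
    using sign_cellD[OF assms, of i] by (auto simp: flip_def)
  then show ?thesis by (simp add: sign_cell_def)
qed

lemma flip_flip:
  assumes "b \<in> sign_cell"
  shows "flip S (flip T b) = flip (sym_diff S T) b"
proof -
  have "flip S (flip T b) $ i = flip (sym_diff S T) b $ i" for i
    using sign_cellD[OF assms, of i] by (auto simp: flip_def)
  then show ?thesis by (simp add: vec_eq_iff)
qed

lemma flip_empty: "flip {} b = b"
  by (simp add: flip_def vec_eq_iff)

lemma flip_involution: "b \<in> sign_cell \<Longrightarrow> flip T (flip T b) = b"
  using flip_flip[of b T T] by (simp add: flip_empty)

lemma abs_flip_nth:
  assumes "b \<in> sign_cell"
  shows "\<bar>flip T b $ i\<bar> = (if i \<in> T then 1 - \<bar>b $ i\<bar> else \<bar>b $ i\<bar>)"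
  using sign_cellD[OF assms, of i] by (auto simp: flip_def)

text \<open>
  In every flipped coordinate, the absolute values of a point and of its flip add up to \<open>1\<close>. This
  bounds the norm of the flip from below, and also the number of coordinates in which two points
  of small norm differ by a flip from above.
\<close>

lemma card_le_l1_norm_flip:
  assumes "b \<in> sign_cell"
  shows "real (card T) \<le> l1_norm b + l1_norm (flip T b)"
proof -
  have "real (card T) = (\<Sum>i\<in>UNIV. if i \<in> T then 1 else 0)"
    by (simp add: sum.If_cases)
  also have "\<dots> \<le> (\<Sum>i\<in>UNIV. \<bar>b $ i\<bar> + \<bar>flip T b $ i\<bar>)"
    by (intro sum_mono) (auto simp: abs_flip_nth[OF assms])
  finally show ?thesis by (simp add: l1_norm_def sum.distrib)
qed

lemma l1_norm_flip_UNIV: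
  fixes b :: "real ^ 'n"
  assumes "b \<in> sign_cell"
  shows "l1_norm (flip UNIV b) = real CARD('n) - l1_norm b"
  by (simp add: l1_norm_def abs_flip_nth[OF assms] sum_subtractf)

lemma l1_norm_flip_zero:
  fixes T :: "'n::finite set"
  shows "l1_norm (flip T 0) = real (card T)"
proof -
  have "(0 :: real ^ 'n) \<in> sign_cell" by (simp add: sign_cell_def)
  then show ?thesis by (simp add: l1_norm_def abs_flip_nth sum.If_cases)
qed

lemma l1_norm_le_card:
  fixes b :: "real ^ 'n"
  assumes "b \<in> sign_cell"
  shows "l1_norm b \<le> real CARD('n)"
  using l1_norm_flip_UNIV[OF assms] l1_norm_nonneg[of "flip UNIV b"] by linarith

lemma flip_diff_int: "flip T b - b \<in> int_lattice"
  by (auto simp: flip_def int_lattice_def)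

text \<open>
  If \<open>flip T b = flip S c\<close>, then \<open>c\<close> is the flip of \<open>b\<close> in the symmetric difference \<open>D\<close> of \<open>S\<close> and
  \<open>T\<close>. The previous bound gives \<open>card D < 1 + 1\<close>, while \<open>card D\<close> is even because \<open>S\<close> and \<open>T\<close> have
  the same size. So \<open>D\<close> is empty.
\<close>

lemma inj_on_flip_l1_ball:
  fixes A :: "(real ^ 'n) set"
  assumes A: "A \<subseteq> {b \<in> sign_cell. l1_norm b < 1}"
  shows "inj_on (\<lambda>(b, T). flip T b) (A \<times> {T. card T = j})"
proof (rule inj_onI)
  fix p q
  assume pq: "p \<in> A \<times> {T. card T = j}" "q \<in> A \<times> {T. card T = j}"
    "(\<lambda>(b, T). flip T b) p = (\<lambda>(b, T). flip T b) q"
  obtain b T c S where p: "p = (b, T)" and q: "q = (c, S)" by (cases p, cases q)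
  have b: "b \<in> A" and c: "c \<in> A" and card: "card T = card S" and eq: "flip T b = flip S c"
    using pq by (auto simp: p q)
  have bc: "b \<in> sign_cell" "c \<in> sign_cell" using A b c by auto
  define D where "D = sym_diff S T"
  have "flip D b = flip S (flip S c)"
    unfolding D_def using flip_flip[OF bc(1)] eq by metis
  also have "\<dots> = c" by (rule flip_involution[OF bc(2)])
  finally have D: "flip D b = c" .
  have "real (card D) < 2"
    using card_le_l1_norm_flip[OF bc(1), of D] subsetD[OF A b] subsetD[OF A c]
    unfolding D by auto
  moreover have "card D + 2 * card (S \<inter> T) = card S + card T"
  proof -
    have "card D = card (S - T) + card (T - S)"
      unfolding D_def by (rule card_Un_disjoint) auto
    moreover have "card S = card (S - T) + card (S \<inter> T)"
      by (subst card_Un_disjoint[symmetric]) (auto intro: arg_cong[of _ _ card])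
    moreover have "card T = card (T - S) + card (S \<inter> T)"
      by (subst card_Un_disjoint[symmetric]) (auto intro: arg_cong[of _ _ card])
    ultimately show ?thesis by linarith
  qed
  then have "even (card D)" using card by presburger
  ultimately have "card D = 0" by (auto elim!: evenE)
  then have "D = {}" by simp
  then have "S = T" unfolding D_def by auto
  moreover have "b = c" using D \<open>D = {}\<close> by (simp add: flip_empty)
  ultimately show "p = q" by (simp add: p q)
qed

section \<open>Counting lattice points in dilated cross-polytopes\<close>

text \<open>
  Pascal's rule for \<open>m + card I choose card I\<close>: a function on \<open>insert a I\<close> whose sum is at most
  \<open>Suc m\<close> either vanishes at \<open>a\<close>, or arises from one whose sum is at most \<open>m\<close> by adding \<open>1\<close> at \<open>a\<close>.
  Requiring the value \<open>0\<close> outside of \<open>I\<close> makes the functions on \<open>I\<close> unique as total functions.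
\<close>

lemma card_bounded_sum_functions:
  assumes "finite I"
  shows "card {\<mu> :: 'a \<Rightarrow> nat. (\<forall>i. i \<notin> I \<longrightarrow> \<mu> i = 0) \<and> sum \<mu> I \<le> m} = (m + card I) choose card I
    \<and> finite {\<mu> :: 'a \<Rightarrow> nat. (\<forall>i. i \<notin> I \<longrightarrow> \<mu> i = 0) \<and> sum \<mu> I \<le> m}"
  using assms
proof (induction I arbitrary: m rule: finite_induct)
  case empty
  have "{\<mu> :: 'a \<Rightarrow> nat. (\<forall>i. i \<notin> {} \<longrightarrow> \<mu> i = 0) \<and> sum \<mu> {} \<le> m} = {\<lambda>_. 0}" for m
    by auto
  then show ?case by simp
next
  case (insert a I)
  let ?F = "\<lambda>I m. {\<mu> :: 'a \<Rightarrow> nat. (\<forall>i. i \<notin> I \<longrightarrow> \<mu> i = 0) \<and> sum \<mu> I \<le> m}"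
  have zero: "\<mu> \<in> ?F (insert a I) m \<and> \<mu> a = 0 \<longleftrightarrow> \<mu> \<in> ?F I m" for \<mu> m
    using insert.hyps by (auto, metis)
  show ?case
  proof (induction m)
    case 0
    have "?F (insert a I) 0 = {\<lambda>_. 0}" using insert.hyps by (auto simp: fun_eq_iff) metis
    then show ?case by simp
  next
    case (Suc m)
    let ?up = "\<lambda>\<mu> :: 'a \<Rightarrow> nat. \<mu>(a := Suc (\<mu> a))"
    have sum_up: "sum (?up \<mu>) I = sum \<mu> I" for \<mu>
      using insert.hyps by (intro sum.cong) auto
    have split: "?F (insert a I) (Suc m) = ?F I (Suc m) \<union> ?up ` ?F (insert a I) m" (is "?L = ?R")
    proof
      show "?R \<subseteq> ?L" using insert.hyps sum_up by (auto simp: zero)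
      show "?L \<subseteq> ?R"
      proof
        fix \<mu> assume \<mu>: "\<mu> \<in> ?L"
        show "\<mu> \<in> ?R"
        proof (cases "\<mu> a")
          case 0
          then show ?thesis using \<mu> zero by blast
        next
          case (Suc t)
          let ?\<nu> = "\<mu>(a := t)"
          have "sum ?\<nu> I = sum \<mu> I" using insert.hyps by (intro sum.cong) auto
          then have "?\<nu> \<in> ?F (insert a I) m" using \<mu> Suc insert.hyps by auto
          moreover have "?up ?\<nu> = \<mu>" using Suc by (auto simp: fun_eq_iff)
          ultimately show ?thesis by (metis (no_types, lifting) UnI2 imageI)
        qed
      qed
    qed
    have disj: "?F I (Suc m) \<inter> ?up ` ?F (insert a I) m = {}"
      using insert.hyps by auto
    have inj: "inj_on ?up (?F (insert a I) m)"
      by (rule inj_onI) (metis fun_upd_eqD fun_upd_triv fun_upd_upd nat.inject)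
    have fin: "finite (?F I (Suc m))" "finite (?F (insert a I) m)"
      using Suc.IH insert.IH by blast+
    have "card ?L = card (?F I (Suc m)) + card (?F (insert a I) m)"
      unfolding split using fin by (subst card_Un_disjoint) (simp_all only: disj card_image[OF inj] finite_imageI)
    also have "\<dots> = (Suc m + card I choose card I) + (m + card (insert a I) choose card (insert a I))"
      using Suc.IH insert.IH[of "Suc m"] by presburger
    also have "\<dots> = (Suc m + card (insert a I)) choose card (insert a I)"
      using insert.hyps by simp
    finally show ?case
      unfolding split using fin by blast
  qed
qed


text \<open>
  The properties that the integer lattice acquires in the coordinates of a basis of integer
  vectors: it may become finer, but it remains closed under shifts by integer points and discrete.
\<close>

locale integral_overlattice =
  fixes \<Lambda> :: "(real ^ 'n) set"
  assumes int_lattice_subset: "int_lattice \<subseteq> \<Lambda>"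
    and add_closed: "x \<in> \<Lambda> \<Longrightarrow> y \<in> \<Lambda> \<Longrightarrow> x + y \<in> \<Lambda>"
    and finite_l1_ball: "finite {x \<in> \<Lambda>. l1_norm x \<le> r}"
begin

text \<open>
  The condition says that \<open>l1_norm b\<close> rounded up is \<open>j\<close>. The shells \<open>0, \<dots>, n\<close> partition the
  points of \<open>\<Lambda>\<close> in the cube; their sizes turn out to be the Ehrhart coefficients.
\<close>

definition shell :: "nat \<Rightarrow> (real ^ 'n) set"
  where "shell j = {b \<in> \<Lambda> \<inter> sign_cell. real j - 1 < l1_norm b \<and> l1_norm b \<le> real j}"

lemma zero_in: "0 \<in> \<Lambda>"
  using int_lattice_subset by (auto simp: int_lattice_def)

lemma flip_in:
  assumes "b \<in> \<Lambda>"
  shows "flip T b \<in> \<Lambda>"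
proof -
  have "flip T b - b \<in> \<Lambda>" using flip_diff_int int_lattice_subset by blast
  from add_closed[OF assms this] show ?thesis by simp
qed

lemma finite_cell: "finite (\<Lambda> \<inter> sign_cell)"
  by (rule finite_subset[OF _ finite_l1_ball[of "real CARD('n)"]]) (auto intro: l1_norm_le_card)

lemma finite_shell: "finite (shell j)"
  by (rule finite_subset[OF _ finite_cell]) (auto simp: shell_def)

lemma shell_above_dim:
  assumes "j > CARD('n)"
  shows "shell j = {}"
proof -
  have "\<not> (real j - 1 < l1_norm b \<and> b \<in> sign_cell)" for b :: "real ^ 'n"
    using l1_norm_le_card[of b] assms by linarith
  then show ?thesis by (auto simp: shell_def)
qed

lemma card_shell_0: "card (shell 0) = 1"
proof -
  have "0 \<in> sign_cell" by (simp add: sign_cell_def)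
  moreover have "-1 < l1_norm x \<and> l1_norm x \<le> 0 \<longleftrightarrow> x = 0" for x :: "real ^ 'n"
    using l1_norm_nonneg[of x] l1_norm_eq_0_iff[of x] by auto
  ultimately have "shell 0 = {0}"
    using zero_in unfolding shell_def by force
  then show ?thesis by simp
qed

text \<open>Flipping all coordinates exchanges the norms above \<open>n - 1\<close> with those below \<open>1\<close>.\<close>

lemma card_shell_dim: "card (shell CARD('n)) = card {b \<in> \<Lambda> \<inter> sign_cell. l1_norm b < 1}"
proof -
  have "bij_betw (flip UNIV) (shell CARD('n)) {b \<in> \<Lambda> \<inter> sign_cell. l1_norm b < 1}"
    by (rule bij_betw_byWitness[where f' = "flip UNIV"])
      (auto simp: shell_def flip_involution flip_in flip_sign_cell l1_norm_flip_UNIV l1_norm_nonneg)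
  then show ?thesis by (rule bij_betw_same_card)
qed

text \<open>
  Each pair in \<open>X\<close> is counted by \<open>X1\<close> or \<open>X2\<close>, and the pairs \<open>(0, T)\<close> by both, so
  \<open>card X1 + card X2\<close> is at least the left-hand side. Flipping in \<open>T\<close> embeds \<open>X1\<close> into the shell
  \<open>j\<close>, and flipping in the complement of \<open>T\<close> embeds \<open>X2\<close> into the shell \<open>n - j\<close>.
\<close>

lemma shell_inequality:
  assumes "j \<le> CARD('n)"
  shows "(CARD('n) choose j) * (card (shell CARD('n)) + card (shell 0))
    \<le> card (shell j) + card (shell (CARD('n) - j))"
proof -
  define A where "A = {b \<in> \<Lambda> \<inter> sign_cell. l1_norm b < 1}"
  define X where "X = A \<times> {T :: 'n set. card T = j}"
  define X1 where "X1 = {(b, T) \<in> X. l1_norm (flip T b) \<le> real j}"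
  define X2 where "X2 = {(b, T) \<in> X. real j \<le> l1_norm (flip T b)}"
  have card_T: "card {T :: 'n set. card T = j} = CARD('n) choose j"
    using n_subsets[of "UNIV :: 'n set" j] by simp
  have "A \<subseteq> \<Lambda> \<inter> sign_cell" by (auto simp: A_def)
  then have "finite A" using finite_cell by (rule finite_subset)
  then have finX: "finite X"
    unfolding X_def by (rule finite_cartesian_product) simp
  have "X1 \<subseteq> X" "X2 \<subseteq> X" unfolding X1_def X2_def by blast+
  then have fin: "finite X1" "finite X2" using finX finite_subset by blast+
  have inj: "inj_on (\<lambda>(b, T). flip T b) X"
    unfolding X_def by (rule inj_on_flip_l1_ball) (auto simp: A_def)
  have above: "real j - 1 < l1_norm (flip T b)" "b \<in> sign_cell" "b \<in> \<Lambda>" if "(b, T) \<in> X" for b T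
  proof -
    have b: "b \<in> sign_cell" "b \<in> \<Lambda>" "l1_norm b < 1" "card T = j"
      using that unfolding X_def A_def by blast+
    show "b \<in> sign_cell" "b \<in> \<Lambda>" by (fact b)+
    show "real j - 1 < l1_norm (flip T b)"
      using card_le_l1_norm_flip[OF b(1), of T] b(3,4) by linarith
  qed
  have "flip T b \<in> shell j" if "(b, T) \<in> X1" for b T
    using that above[of b T] flip_in[of b T] flip_sign_cell[of b T] by (simp add: X1_def shell_def)
  then have "(\<lambda>(b, T). flip T b) ` X1 \<subseteq> shell j" by auto
  then have 1: "card X1 \<le> card (shell j)"
    by (intro card_inj_on_le[OF inj_on_subset[OF inj] _ finite_shell]) (use \<open>X1 \<subseteq> X\<close> in auto)
  have "flip UNIV (flip T b) \<in> shell (CARD('n) - j)" if "(b, T) \<in> X2" for b T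
  proof -
    have bT: "(b, T) \<in> X" and le: "real j \<le> l1_norm (flip T b)" using that by (auto simp: X2_def)
    note ab = above[OF bT]
    \<comment> \<open>The flip of \<open>b\<close> in the \<open>n - j\<close> coordinates outside of \<open>T\<close> has norm above \<open>n - j - 1\<close>.\<close>
    have "real CARD('n) - real j = real (card (- T))"
      using bT assms card_Diff_subset[of T UNIV]
      unfolding Compl_eq_Diff_UNIV by (auto simp: X_def of_nat_diff)
    also have "\<dots> \<le> l1_norm b + l1_norm (flip (- T) b)"
      by (rule card_le_l1_norm_flip[OF ab(2)])
    also have "flip (- T) b = flip UNIV (flip T b)"
    proof -
      have "sym_diff UNIV T = - T" by auto
      then show ?thesis using flip_flip[OF ab(2), of UNIV T] by metis
    qed
    finally have "real CARD('n) - real j \<le> l1_norm b + l1_norm (flip UNIV (flip T b))" .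
    moreover have "l1_norm b < 1" using bT by (auto simp: X_def A_def)
    ultimately show ?thesis
      using le l1_norm_flip_UNIV[OF flip_sign_cell[OF ab(2)], of T] assms ab
      by (auto simp: shell_def flip_in flip_sign_cell of_nat_diff)
  qed
  then have sub: "(\<lambda>(b, T). flip UNIV (flip T b)) ` X2 \<subseteq> shell (CARD('n) - j)"
    by auto
  have "inj_on (\<lambda>(b, T). flip UNIV (flip T b)) X"
  proof (rule inj_onI, clarify)
    fix b T c S
    assume bT: "(b, T) \<in> X" and cS: "(c, S) \<in> X"
      and eq: "flip UNIV (flip T b) = flip UNIV (flip S c)"
    have "flip T b = flip S c"
      using eq flip_involution flip_sign_cell above(2)[OF bT] above(2)[OF cS] by metis
    then show "b = c \<and> T = S" using inj_onD[OF inj _ bT cS] by simp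
  qed
  then have 2: "card X2 \<le> card (shell (CARD('n) - j))"
    by (rule card_inj_on_le[OF inj_on_subset[OF _ \<open>X2 \<subseteq> X\<close>] sub finite_shell])
  have "{0} \<times> {T. card T = j} \<subseteq> X1 \<inter> X2"
    by (auto simp: X1_def X2_def X_def A_def zero_in l1_norm_flip_zero sign_cell_def l1_norm_def[of 0])
  then have "card ({0 :: real ^ 'n} \<times> {T :: 'n set. card T = j}) \<le> card (X1 \<inter> X2)"
    using fin by (intro card_mono) auto
  then have 3: "CARD('n) choose j \<le> card (X1 \<inter> X2)"
    by (simp add: card_cartesian_product card_T)
  have "X1 \<union> X2 = X" by (auto simp: X1_def X2_def)
  then have "card X1 + card X2 = card X + card (X1 \<inter> X2)"
    using card_Un_Int[OF fin] by simp
  moreover have "card X = (CARD('n) choose j) * card (shell CARD('n))"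
    by (simp add: X_def card_cartesian_product card_T card_shell_dim A_def)
  ultimately show ?thesis
    using 1 2 3 by (simp add: card_shell_0 algebra_simps)
qed

text \<open>
  Moving every coordinate away from the origin by an integer. Coordinates equal to \<open>0\<close> move in the
  positive direction, those equal to \<open>-1\<close> in the negative one; this is what the choice of the
  half-open interval \<open>[-1, 1)\<close> is for, and it makes the representation of a point unique.
\<close>

definition translate :: "real ^ 'n \<Rightarrow> ('n \<Rightarrow> nat) \<Rightarrow> real ^ 'n"
  where "translate b \<mu> = (\<chi> i. if b $ i \<ge> 0 then b $ i + real (\<mu> i) else b $ i - real (\<mu> i))"

lemma l1_norm_translate: "l1_norm (translate b \<mu>) = l1_norm b + real (sum \<mu> UNIV)"
  unfolding l1_norm_def translate_def of_nat_sum sum.distrib[symmetric]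
  by (intro sum.cong) auto

lemma translate_in: "b \<in> \<Lambda> \<Longrightarrow> translate b \<mu> \<in> \<Lambda>"
proof -
  assume "b \<in> \<Lambda>"
  moreover have "translate b \<mu> - b \<in> int_lattice"
    by (auto simp: translate_def int_lattice_def)
  ultimately show ?thesis using add_closed[of b "translate b \<mu> - b"] int_lattice_subset by auto
qed

lemma translate_inj:
  assumes "b \<in> sign_cell" "c \<in> sign_cell" "translate b \<mu> = translate c \<nu>"
  shows "b = c \<and> \<mu> = \<nu>"
proof -
  have "b $ i = c $ i \<and> \<mu> i = \<nu> i" for i
  proof -
    have bd: "-1 \<le> b $ i" "b $ i < 1" "-1 \<le> c $ i" "c $ i < 1"
      using assms by (auto simp: sign_cell_def)
    have eq: "translate b \<mu> $ i = translate c \<nu> $ i" using assms by simp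
    \<comment> \<open>Translation keeps the sign, so \<open>b $ i\<close> and \<open>c $ i\<close> lie in the same half of \<open>[-1, 1)\<close>.\<close>
    have sgn: "b $ i \<ge> 0 \<longleftrightarrow> c $ i \<ge> 0"
      using eq bd by (auto simp: translate_def split: if_splits)
    have "\<mu> i = \<nu> i"
    proof -
      have "\<bar>real (\<mu> i) - real (\<nu> i)\<bar> < 1"
        using eq bd sgn by (auto simp: translate_def split: if_splits)
      then show ?thesis by linarith
    qed
    then show ?thesis using eq sgn by (auto simp: translate_def split: if_splits)
  qed
  then show ?thesis by (auto simp: vec_eq_iff fun_eq_iff)
qed

lemma translate_surj:
  assumes "x \<in> \<Lambda>"
  obtains b \<mu> where "b \<in> \<Lambda> \<inter> sign_cell" "x = translate b \<mu>"
proof -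
  define b where "b = (\<chi> i. if x $ i \<ge> 0 then frac (x $ i) else frac (x $ i) - 1)"
  define \<mu> where "\<mu> i = (if x $ i \<ge> 0 then nat \<lfloor>x $ i\<rfloor> else nat (- \<lfloor>x $ i\<rfloor> - 1))" for i
  have "b - x \<in> int_lattice"
    by (auto simp: b_def int_lattice_def frac_def)
  then have "b \<in> \<Lambda>" using add_closed[OF assms, of "b - x"] int_lattice_subset by auto
  moreover have "b \<in> sign_cell"
    by (auto simp: sign_cell_def b_def frac_lt_1 intro: order_trans[OF _ frac_ge_0]
        order.strict_trans[OF frac_lt_1])
  moreover have "x = translate b \<mu>"
  proof -
    have "x $ i = translate b \<mu> $ i" for i
    proof (cases "x $ i \<ge> 0")
      case True
      then show ?thesis by (simp add: translate_def b_def \<mu>_def frac_def)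
    next
      case False
      then have "frac (x $ i) - 1 < 0" "\<lfloor>x $ i\<rfloor> \<le> -1"
        using frac_lt_1[of "x $ i"] by (simp, linarith)
      then show ?thesis using False
        by (simp add: translate_def b_def \<mu>_def frac_def)
    qed
    then show ?thesis by (simp add: vec_eq_iff)
  qed
  ultimately show ?thesis using that by blast
qed

text \<open>
  By unique translation the ball is the disjoint union of the translates of the points \<open>b\<close> of the
  cube. The admissible \<open>\<mu>\<close> for \<open>b\<close> in the shell \<open>i\<close> are those with sum at most \<open>k - i\<close>, since sums
  of \<open>\<mu>\<close> are integers; for \<open>i > k\<close> there are none, and the binomial coefficient vanishes as well.
\<close>

lemma card_l1_ball:
  "card {x \<in> \<Lambda>. l1_norm x \<le> real k} =
    (\<Sum>i = 0..CARD('n). card (shell i) * ((k + CARD('n) - i) choose CARD('n)))"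
proof -
  let ?n = "CARD('n)"
  define M where "M b = {\<mu> :: 'n \<Rightarrow> nat. l1_norm b + real (sum \<mu> UNIV) \<le> real k}" for b :: "real ^ 'n"
  have M: "card (M b) = (k + ?n - i) choose ?n \<and> finite (M b)" if "b \<in> shell i" for b i
  proof (cases "i \<le> k")
    case True
    have "l1_norm b + real s \<le> real k \<longleftrightarrow> s \<le> k - i" for s :: nat
      using that True unfolding shell_def by auto
    then have "M b = {\<mu>. (\<forall>i. i \<notin> UNIV \<longrightarrow> \<mu> i = 0) \<and> sum \<mu> UNIV \<le> k - i}"
      by (simp add: M_def del: of_nat_sum)
    then show ?thesis
      using card_bounded_sum_functions[of "UNIV :: 'n set" "k - i"] True by simp
  next
    case False
    have "M b = {}"
    proof -
      have "real i - 1 < l1_norm b" using that by (simp add: shell_def)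
      moreover have "real k \<le> real i - 1" using False by linarith
      ultimately have "real k < l1_norm b + real (sum \<mu> UNIV)" for \<mu> by linarith
      then show ?thesis by (auto simp: M_def not_le[symmetric])
    qed
    moreover have "0 < ?n" by simp
    then have "k + ?n - i < ?n" using False by linarith
    ultimately show ?thesis by (simp add: binomial_eq_0)
  qed
  have disj: "shell i \<inter> shell j = {}" if "i \<noteq> j" for i j
    using that by (fastforce simp: shell_def)
  have cells: "\<Lambda> \<inter> sign_cell = (\<Union>i\<in>{0..?n}. shell i)"
  proof
    show "\<Lambda> \<inter> sign_cell \<subseteq> (\<Union>i\<in>{0..?n}. shell i)"
    proof
      fix b assume b: "b \<in> \<Lambda> \<inter> sign_cell"
      define i where "i = nat \<lceil>l1_norm b\<rceil>"
      have "i \<le> ?n" using l1_norm_le_card[of b] b unfolding i_def by (simp add: ceiling_le_iff)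
      moreover have "b \<in> shell i"
        using b l1_norm_nonneg[of b] unfolding shell_def i_def by auto linarith+
      ultimately show "b \<in> (\<Union>i\<in>{0..?n}. shell i)" by auto
    qed
  qed (auto simp: shell_def)
  have "bij_betw (\<lambda>(b, \<mu>). translate b \<mu>) (SIGMA b:\<Lambda> \<inter> sign_cell. M b)
      {x \<in> \<Lambda>. l1_norm x \<le> real k}"
    unfolding bij_betw_def
  proof
    show "inj_on (\<lambda>(b, \<mu>). translate b \<mu>) (SIGMA b:\<Lambda> \<inter> sign_cell. M b)"
      using translate_inj by (auto simp: inj_on_def)
    show "(\<lambda>(b, \<mu>). translate b \<mu>) ` (SIGMA b:\<Lambda> \<inter> sign_cell. M b) = {x \<in> \<Lambda>. l1_norm x \<le> real k}"
      (is "?L = ?R")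
    proof
      show "?L \<subseteq> ?R" by (auto simp: translate_in l1_norm_translate M_def)
      show "?R \<subseteq> ?L"
      proof
        fix x assume x: "x \<in> ?R"
        then obtain b \<mu> where b: "b \<in> \<Lambda> \<inter> sign_cell" "x = translate b \<mu>"
          using translate_surj by blast
        then have "(b, \<mu>) \<in> (SIGMA b:\<Lambda> \<inter> sign_cell. M b)"
          using x by (simp add: M_def l1_norm_translate)
        then show "x \<in> ?L" using b(2) by force
      qed
    qed
  qed
  then have "card {x \<in> \<Lambda>. l1_norm x \<le> real k} = card (SIGMA b:\<Lambda> \<inter> sign_cell. M b)"
    by (rule bij_betw_same_card[symmetric])
  also have "\<dots> = (\<Sum>b\<in>\<Lambda> \<inter> sign_cell. card (M b))"
    using finite_cell M cells by (intro card_SigmaI) auto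
  also have "\<dots> = (\<Sum>i = 0..?n. \<Sum>b\<in>shell i. card (M b))"
    unfolding cells by (rule sum.UNION_disjoint) (auto simp: finite_shell disj)
  also have "\<dots> = (\<Sum>i = 0..?n. card (shell i) * ((k + ?n - i) choose ?n))"
    using M by (intro sum.cong) auto
  finally show ?thesis .
qed

end

text \<open>
  The coefficients in the binomial basis are unique: in the equation for \<open>k\<close> the binomials with
  \<open>i > k\<close> vanish and the one with \<open>i = k\<close> is \<open>1\<close>, so the linear system is triangular.
\<close>

lemma ehrhart_coeff_eqI:
  fixes P :: "(real ^ 'n) set"
  assumes above: "\<And>i. i > CARD('n) \<Longrightarrow> a i = 0"
    and count: "\<And>k::nat. real (lattice_count ((\<lambda>x. real k *\<^sub>R x) ` P)) =
      (\<Sum>i = 0..CARD('n). a i * real ((k + CARD('n) - i) choose CARD('n)))"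
  shows "ehrhart_coeff P = a"
  unfolding ehrhart_coeff_def
proof (rule the_equality)
  let ?n = "CARD('n)"
  fix b :: "nat \<Rightarrow> real"
  assume b: "(\<forall>i > ?n. b i = 0) \<and> (\<forall>k::nat. real (lattice_count ((\<lambda>x. real k *\<^sub>R x) ` P)) =
      (\<Sum>i = 0..?n. b i * real ((k + ?n - i) choose ?n)))"
  have "b k = a k" for k
  proof (induction k rule: less_induct)
    case (less k)
    show ?case
    proof (cases "k \<le> ?n")
      case True
      have "(\<Sum>i = 0..?n. b i * real ((k + ?n - i) choose ?n)) =
          (\<Sum>i = 0..?n. a i * real ((k + ?n - i) choose ?n))"
        using b count by metis
      then have "0 = (\<Sum>i = 0..?n. (b i - a i) * real ((k + ?n - i) choose ?n))"
        by (simp add: left_diff_distrib sum_subtractf)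
      also have "\<dots> = (\<Sum>i = 0..?n. if i = k then b k - a k else 0)"
      proof (rule sum.cong)
        fix i assume "i \<in> {0..?n}"
        consider "i < k" | "i = k" | "i > k" by linarith
        then show "(b i - a i) * real ((k + ?n - i) choose ?n) = (if i = k then b k - a k else 0)"
        proof cases
          case 3
          then have "(k + ?n - i) choose ?n = 0"
            using \<open>i \<in> {0..?n}\<close> by (intro binomial_eq_0) auto
          then show ?thesis using 3 by simp
        qed (use less in auto)
      qed simp
      also have "\<dots> = b k - a k" using True by simp
      finally show ?thesis by simp
    next
      case False
      then show ?thesis using above b by simp
    qed
  qed
  then show "b = a" by auto
qed (use assms in auto)


section \<open>Symmetric polytopes as linear images of the cross-polytope\<close>

lemma finite_int_lattice_bounded:
  fixes S :: "(real ^ 'n) set"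
  assumes "bounded S"
  shows "finite (S \<inter> int_lattice)"
proof -
  obtain B where B: "\<And>x. x \<in> S \<Longrightarrow> norm x \<le> B"
    using assms unfolding bounded_iff by blast
  let ?F = "(\<lambda>f. \<chi> i. real_of_int (f i)) ` (UNIV \<rightarrow>\<^sub>E {- \<lceil>B\<rceil>..\<lceil>B\<rceil>}) :: (real ^ 'n) set"
  have "S \<inter> int_lattice \<subseteq> ?F"
  proof
    fix x assume x: "x \<in> S \<inter> int_lattice"
    have "\<bar>x $ i\<bar> \<le> B" for i using B[of x] component_le_norm_cart[of x i] x by auto
    then have "\<lfloor>x $ i\<rfloor> \<in> {- \<lceil>B\<rceil>..\<lceil>B\<rceil>}" for i
      by (smt (verit, best) atLeastAtMost_iff ceiling_minus floor_mono floor_le_ceiling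
          le_floor_iff le_of_int_ceiling of_int_minus order_trans)
    moreover have "x = (\<chi> i. real_of_int \<lfloor>x $ i\<rfloor>)"
      using x by (auto simp: vec_eq_iff int_lattice_def)
    ultimately show "x \<in> ?F" by (intro image_eqI[of _ _ "\<lambda>i. \<lfloor>x $ i\<rfloor>"]) auto
  qed
  moreover have "finite ?F" by (intro finite_imageI finite_PiE) auto
  ultimately show ?thesis by (rule finite_subset)
qed

definition frame_map :: "('n \<Rightarrow> real ^ 'n) \<Rightarrow> real ^ 'n \<Rightarrow> real ^ 'n"
  where "frame_map v c = (\<Sum>i\<in>UNIV. c $ i *\<^sub>R v i)"

lemma linear_frame_map: "linear (frame_map v)"
  by (intro linearI) (simp_all add: frame_map_def scaleR_left_distrib sum.distrib scaleR_sum_right)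

lemma inj_frame_map:
  fixes v :: "'n \<Rightarrow> real ^ 'n"
  assumes "inj v" "independent (range v)"
  shows "inj (frame_map v)"
  unfolding linear_injective_0[OF linear_frame_map]
proof (intro allI impI)
  fix c :: "real ^ 'n" assume "frame_map v c = 0"
  then have "(\<Sum>x\<in>range v. c $ (inv v x) *\<^sub>R x) = 0"
    using assms(1) by (simp add: sum.reindex frame_map_def)
  then have "c $ (inv v (v i)) = 0" for i
    using independentD[OF assms(2), of "range v" "\<lambda>x. c $ (inv v x)" "v i"] by auto
  then show "c = 0" using assms(1) by (simp add: vec_eq_iff)
qed

lemma bounded_l1_ball: "bounded {c :: real ^ 'n. l1_norm c \<le> r}"
  using norm_le_l1_cart unfolding bounded_iff l1_norm_def by (metis (mono_tags) mem_Collect_eq order_trans)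

lemma convex_l1_ball: "convex {c :: real ^ 'n. l1_norm c \<le> r}"
proof (rule convexI, clarify)
  fix x y :: "real ^ 'n" and s t :: real
  assume *: "l1_norm x \<le> r" "l1_norm y \<le> r" "0 \<le> s" "0 \<le> t" "s + t = 1"
  have "l1_norm (s *\<^sub>R x + t *\<^sub>R y) \<le> s * l1_norm x + t * l1_norm y"
    using l1_norm_triangle[of "s *\<^sub>R x" "t *\<^sub>R y"] * by (simp add: l1_norm_scaleR)
  also have "\<dots> \<le> r" using * by (intro convex_bound_le) auto
  finally show "l1_norm (s *\<^sub>R x + t *\<^sub>R y) \<le> r" .
qed

text \<open>
  A point with coordinates \<open>c\<close> is the combination of the points \<open>\<plusminus>v\<^sub>i\<close>, signed like the \<open>c\<^sub>i\<close>, with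
  weights \<open>\<bar>c\<^sub>i\<bar>\<close>; the weight missing to \<open>1\<close> goes to the origin, which is the midpoint of \<open>v\<^sub>i\<close>
  and \<open>-v\<^sub>i\<close>.
\<close>

lemma convex_hull_symmetric_frame:
  fixes v :: "'n \<Rightarrow> real ^ 'n"
  shows "convex hull (range v \<union> uminus ` range v) = frame_map v ` {c. l1_norm c \<le> 1}"
    (is "?H = ?Q")
proof
  show "?H \<subseteq> ?Q"
  proof (rule hull_minimal)
    have "v i = frame_map v (axis i 1)" "- v i = frame_map v (- axis i 1)" for i
      by (simp_all add: frame_map_def axis_def if_distrib[of "\<lambda>t. t *\<^sub>R _"] sum_negf cong: if_cong)
    moreover have "l1_norm (axis i 1 :: real ^ 'n) \<le> 1" "l1_norm (- axis i 1 :: real ^ 'n) \<le> 1" for i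
      by (simp_all add: l1_norm_def axis_def if_distrib[of abs] cong: if_cong)
    ultimately show "range v \<union> uminus ` range v \<subseteq> ?Q" by blast
    show "convex ?Q" by (intro convex_linear_image linear_frame_map convex_l1_ball)
  qed
  show "?Q \<subseteq> ?H"
  proof clarify
    fix c :: "real ^ 'n" assume c: "l1_norm c \<le> 1"
    define u where "u i = (if c $ i \<ge> 0 then v i else - v i)" for i
    have u: "u i \<in> ?H" for i by (rule hull_inc) (simp add: u_def)
    have "v i \<in> ?H" "- v i \<in> ?H" for i by (auto intro: hull_inc)
    then have "(1/2) *\<^sub>R v i + (1/2) *\<^sub>R (- v i) \<in> ?H" for i
      by (intro convexD[OF convex_convex_hull]) auto
    then have zero: "0 \<in> ?H" by simp
    have eq: "frame_map v c = (\<Sum>i\<in>UNIV. \<bar>c $ i\<bar> *\<^sub>R u i)"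
      unfolding frame_map_def u_def by (intro sum.cong) auto
    show "frame_map v c \<in> ?H"
    proof (cases "c = 0")
      case True
      then show ?thesis using zero by (simp add: frame_map_def)
    next
      case False
      then have pos: "l1_norm c > 0"
        using l1_norm_nonneg[of c] l1_norm_eq_0_iff[of c] by linarith
      let ?w = "\<Sum>i\<in>UNIV. (\<bar>c $ i\<bar> / l1_norm c) *\<^sub>R u i"
      have "?w \<in> ?H"
        using pos u by (intro convex_sum) (auto simp: sum_divide_distrib[symmetric] l1_norm_def[symmetric])
      then have "(1 - l1_norm c) *\<^sub>R 0 + l1_norm c *\<^sub>R ?w \<in> ?H"
        using c pos zero by (intro convexD[OF convex_convex_hull]) auto
      moreover have "l1_norm c *\<^sub>R ?w = frame_map v c"
        using pos by (simp add: eq scaleR_sum_right)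
      ultimately show ?thesis by simp
    qed
  qed
qed

lemma scaled_frame_image:
  "(\<lambda>x. real k *\<^sub>R x) ` frame_map v ` {c. l1_norm c \<le> 1} = frame_map v ` {c. l1_norm c \<le> real k}"
  (is "?L = ?R")
proof
  have scale: "real k *\<^sub>R frame_map v c = frame_map v (real k *\<^sub>R c)" for c
    by (simp add: linear_cmul[OF linear_frame_map])
  show "?L \<subseteq> ?R"
    using mult_left_mono[of _ 1 "real k"] by (fastforce simp: scale l1_norm_scaleR)
  show "?R \<subseteq> ?L"
  proof clarify
    fix c :: "real ^ 'a" assume c: "l1_norm c \<le> real k"
    have "c = real k *\<^sub>R ((1 / real k) *\<^sub>R c)"
      using c l1_norm_nonneg[of c] l1_norm_eq_0_iff[of c] by (cases "k = 0") auto
    moreover have "l1_norm ((1 / real k) *\<^sub>R c) \<le> 1"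
      using c by (simp add: l1_norm_scaleR divide_le_eq)
    ultimately show "frame_map v c \<in> ?L"
      using scale by (metis (mono_tags, lifting) imageI mem_Collect_eq)
  qed
qed

lemma integral_overlattice_frame:
  fixes v :: "'n \<Rightarrow> real ^ 'n"
  assumes v: "inj v" "independent (range v)" and int: "range v \<subseteq> int_lattice"
  shows "integral_overlattice {c. frame_map v c \<in> int_lattice}"
proof
  show "int_lattice \<subseteq> {c. frame_map v c \<in> int_lattice}"
    using int by (auto simp: int_lattice_def frame_map_def image_subset_iff intro!: Ints_sum Ints_mult)
  show "x + y \<in> {c. frame_map v c \<in> int_lattice}"
    if "x \<in> {c. frame_map v c \<in> int_lattice}" "y \<in> {c. frame_map v c \<in> int_lattice}" for x y
    using that by (auto simp: int_lattice_def linear_add[OF linear_frame_map])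
  fix r
  have "frame_map v ` {x \<in> {c. frame_map v c \<in> int_lattice}. l1_norm x \<le> r}
    \<subseteq> frame_map v ` {c. l1_norm c \<le> r} \<inter> int_lattice" by auto
  moreover have "finite (frame_map v ` {c. l1_norm c \<le> r} \<inter> int_lattice)"
    by (intro finite_int_lattice_bounded bounded_linear_image bounded_l1_ball
        linear_conv_bounded_linear[THEN iffD1] linear_frame_map)
  ultimately show "finite {x \<in> {c. frame_map v c \<in> int_lattice}. l1_norm x \<le> r}"
    using inj_frame_map[OF v] by (meson finite_imageD finite_subset inj_on_subset subset_UNIV)
qed

text \<open>
  The vertices span the space, so they contain a basis \<open>B\<close>, which has \<open>n\<close> elements. A basis
  contains no vector together with its negative, so \<open>B\<close> and \<open>-B\<close> are disjoint sets of vertices.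
  Together they have \<open>2n\<close> elements, hence exhaust the vertices.
\<close>

lemma symmetric_polytope_frame:
  fixes P :: "(real ^ 'n) set"
  assumes P: "P \<in> symmetric_lattice_polytopes" and card: "card (vertices P) = 2 * CARD('n)"
  obtains v :: "'n \<Rightarrow> real ^ 'n" where "inj v" "independent (range v)"
    "range v \<subseteq> int_lattice" "P = convex hull (range v \<union> uminus ` range v)"
proof -
  define V where "V = vertices P"
  have poly: "polytope P" and dim: "aff_dim P = int CARD('n)" and sym: "uminus ` P = P"
    and int: "V \<subseteq> int_lattice"
    using P by (auto simp: symmetric_lattice_polytopes_def V_def)
  have hull: "P = convex hull V"
    unfolding V_def vertices_def
    by (intro Krein_Milman_Minkowski polytope_imp_compact polytope_imp_convex poly)
  have finV: "finite V"
    using card card_ge_0_finite[of V] by (simp add: V_def)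
  have negV: "- x \<in> V" if "x \<in> V" for x
  proof -
    have "linear (uminus :: real ^ 'n \<Rightarrow> real ^ 'n)" "inj (uminus :: real ^ 'n \<Rightarrow> real ^ 'n)"
      by (intro linearI) simp_all
    moreover have "{x} face_of P"
      using that by (simp add: V_def vertices_def face_of_singleton)
    ultimately have "uminus ` {x} face_of uminus ` P"
      by (simp only: face_of_linear_image)
    then have "- x extreme_point_of P" using sym by (simp add: face_of_singleton)
    then show ?thesis by (simp add: V_def vertices_def)
  qed
  have "affine hull P \<subseteq> span V"
  proof -
    have "affine hull P = affine hull V" unfolding hull by simp
    then show ?thesis using affine_hull_subset_span by metis
  qed
  moreover have "affine hull P = UNIV" using dim aff_dim_eq_full[of P] by simp
  ultimately have spanV: "span V = UNIV" by auto
  obtain B where B: "B \<subseteq> V" "independent B" "V \<subseteq> span B"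
    using maximal_independent_subset by blast
  have "span B = UNIV" using spanV B(3) by (metis span_span span_mono top.extremum_unique)
  then have cardB: "card B = CARD('n)"
    using B(2) basis_card_eq_dim[of B UNIV] by simp
  have finB: "finite B" using B finV finite_subset by blast
  have disj: "B \<inter> uminus ` B = {}"
  proof (rule ccontr)
    assume "B \<inter> uminus ` B \<noteq> {}"
    then obtain b where b: "b \<in> B" "- b \<in> B" by auto
    have "b \<noteq> 0" using b(1) B(2) dependent_zero by blast
    then have "- b \<in> B - {b}" using b by (auto simp: eq_neg_iff_add_eq_0 vec_eq_iff)
    then have "b \<in> span (B - {b})" using span_neg[OF span_base, of "- b" "B - {b}"] by simp
    then show False using B(2) b(1) by (auto simp: dependent_def)
  qed
  have "card (B \<union> uminus ` B) = card V"
    using card_Un_disjoint[OF finB finite_imageI[OF finB] disj] cardB card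
    by (simp add: card_image V_def)
  moreover have "B \<union> uminus ` B \<subseteq> V" using B(1) negV by auto
  ultimately have V: "B \<union> uminus ` B = V" using finV card_subset_eq by blast
  obtain v :: "'n \<Rightarrow> real ^ 'n" where v: "bij_betw v UNIV B"
    using finite_same_card_bij[of "UNIV :: 'n set" B] finB cardB by auto
  then have "inj v" "range v = B" by (auto simp: bij_betw_def)
  then show thesis using that B V int hull by blast
qed

theorem lemma1p5:
  fixes P :: "(real ^ 'n) set" and i :: nat
  assumes "P \<in> symmetric_lattice_polytopes"
    and "card (vertices P) = 2 * CARD('n)"
    and "i \<le> CARD('n)"
  shows "ehrhart_coeff P i + ehrhart_coeff P (CARD('n) - i)
    \<ge> real (CARD('n) choose i) * (ehrhart_coeff P (CARD('n)) + ehrhart_coeff P 0)"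
proof -
  obtain v :: "'n \<Rightarrow> real ^ 'n" where v: "inj v" "independent (range v)"
    "range v \<subseteq> int_lattice" and P: "P = convex hull (range v \<union> uminus ` range v)"
    using symmetric_polytope_frame[OF assms(1,2)] by blast
  define \<Lambda> where "\<Lambda> = {c. frame_map v c \<in> int_lattice}"
  interpret integral_overlattice \<Lambda>
    unfolding \<Lambda>_def by (rule integral_overlattice_frame[OF v])
  have "ehrhart_coeff P = (\<lambda>j. real (card (shell j)))"
  proof (rule ehrhart_coeff_eqI)
    show "real (card (shell j)) = 0" if "j > CARD('n)" for j
      using that by (simp add: shell_above_dim)
    fix k :: nat
    have "(\<lambda>x. real k *\<^sub>R x) ` P \<inter> int_lattice = frame_map v ` {x \<in> \<Lambda>. l1_norm x \<le> real k}"
      unfolding P convex_hull_symmetric_frame scaled_frame_image by (auto simp: \<Lambda>_def)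
    then have "lattice_count ((\<lambda>x. real k *\<^sub>R x) ` P) = card {x \<in> \<Lambda>. l1_norm x \<le> real k}"
      using inj_frame_map[OF v(1,2)] by (simp add: lattice_count_def card_image inj_on_subset)
    then show "real (lattice_count ((\<lambda>x. real k *\<^sub>R x) ` P)) = (\<Sum>i = 0..CARD('n).
        real (card (shell i)) * real ((k + CARD('n) - i) choose CARD('n)))"
      by (simp add: card_l1_ball)
  qed
  then show ?thesis
    using of_nat_mono[OF shell_inequality[OF assms(3)], where ?'a = real] by simp
qed

end
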